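(* Consider a robot with nominal unicycle dynamics $\dot p_{\mathrm n}^x=\nu_{\mathrm n}\cos\theta_{\mathrm n}$, $\dot p_{\mathrm n}^y=\nu_{\mathrm n}\sin\theta_{\mathrm n}$, $\dot\theta_{\mathrm n}=\omega_{\mathrm n}$, and attacked dynamics $\dot p^x=\nu\cos\theta$, $\dot p^y=\nu\sin\theta$, $\dot\theta=\omega$, with equal initial configurations. Let $\phi_{\mathrm n}=\operatorname{angle}(p_{\mathrm n},\dot p_{\mathrm n})$ and $\phi=\operatorname{angle}(p,\dot p)$. The attack $(\nu,\omega,u^{\mathrm{GNSS}})$ is undetectable if and only if, at all times, $$\nu\cos(\phi)=\nu_{\mathrm n}\cos(\phi_{\mathrm n})\quad\text{and}\quad u^{\mathrm{GNSS}}=p_{\mathrm n}-p .$$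
   Context: Nominal robot: position $p_{\mathrm n}=[p_{\mathrm n}^x\ p_{\mathrm n}^y]^{\mathsf T}:\mathbb{R}_{\ge0}\to\mathbb{R}^2$, steering angle $\theta_{\mathrm n}:\mathbb{R}_{\ge0}\to[0,2\pi)$ (an angle modulo $2\pi$), wheel velocity $\nu_{\mathrm n}:\mathbb{R}_{\ge0}\to\mathbb{R}_{\ge0}$ (differentiable, $\nu_{\mathrm n}\le\nu_{\max}$), steering control $\omega_{\mathrm n}:\mathbb{R}_{\ge0}\to\mathbb{R}$ (piecewise continuous, $|\omega_{\mathrm n}|\le\omega_{\max}$), where $\nu_{\max},\omega_{\max}>0$. Attacked robot: position $p=[p^x\ p^y]^{\mathsf T}$, steering angle $\theta$ (an angle modulo $2\pi$), attacked wheel velocity $\nu:\mathbb{R}_{\ge0}\to\mathbb{R}_{\ge0}$ and steering control $\omega:\mathbb{R}_{\ge0}\to\mathbb{R}$, with the same regularity as the nominal ones. It is assumed that $p(0)=p_{\mathrm n}(0)$ and $\theta(0)=\theta_{\mathrm n}(0)$. Measurements: nominal $y^{\mathrm{GNSS}}_{\mathrm n}=p_{\mathrm n}$, $y^{\mathrm{RSSI}}_{\mathrm n}=p_{\mathrm n}^{\mathsf T}p_{\mathrm n}$; under attack $y^{\mathrm{GNSS}}=p+u^{\mathrm{GNSS}}$, $y^{\mathrm{RSSI}}=p^{\mathsf T}p$, where $u^{\mathrm{GNSS}}:\mathbb{R}_{\ge0}\to\mathbb{R}^2$ is the spoofing signal. Undetectable attack: the attack is undetectable if $y^{\mathrm{GNSS}}=y^{\mathrm{GNSS}}_{\mathrm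 n}$ and $y^{\mathrm{RSSI}}=y^{\mathrm{RSSI}}_{\mathrm n}$ at all times, and detectable otherwise. Angle: $\operatorname{angle}(a,b)=\arccos\!\left(\frac{a^{\mathsf T}b}{\|a\|\,\|b\|}\right)$ for nonzero $a,b\in\mathbb{R}^2$, with $\operatorname{angle}(0,b)=\operatorname{angle}(a,0)=0$. *)

theory Defs
  imports "HOL-Analysis.Analysis" "HOL-Library.Real_Mod"
begin

text \<open>
  Signals on the nonnegative time axis are total functions on \<^typ>\<open>real\<close> of which only the
  values at times \<open>t \<ge> 0\<close> matter.  Derivatives are taken within \<open>{0..}\<close>, that is, they are
  two-sided for \<open>t > 0\<close> and right derivatives at \<open>t = 0\<close>.
\<close>

definition piecewise_continuous :: "(real \<Rightarrow> real) \<Rightarrow> bool" where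
  "piecewise_continuous f \<longleftrightarrow>
     (\<forall>T\<ge>0. finite {t \<in> {0..T}. \<not> continuous (at t within {0..}) f}) \<and>
     (\<forall>t\<ge>0. \<exists>l. (f \<longlongrightarrow> l) (at_right t)) \<and>
     (\<forall>t>0. \<exists>l. (f \<longlongrightarrow> l) (at_left t))"

text \<open>
  \<open>\<theta>' = \<omega>\<close> for an angle \<open>\<theta>\<close> modulo \<open>2\<pi>\<close>: the representative \<open>\<theta>\<close> in \<open>[0, 2\<pi>)\<close> may jump when it
  wraps around, so the differential equation is imposed on a continuous lift \<open>\<Theta>\<close> of \<open>\<theta>\<close>.
  As \<open>\<omega>\<close> is only piecewise continuous, it is required at the continuity points of \<open>\<omega>\<close>.
\<close>

definition has_angular_velocity :: "(real \<Rightarrow> real) \<Rightarrow> (real \<Rightarrow> real) \<Rightarrow> bool" where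
  "has_angular_velocity \<theta> \<omega> \<longleftrightarrow>
     (\<exists>\<Theta>. continuous_on {0..} \<Theta> \<and>
        (\<forall>t\<ge>0. [\<theta> t = \<Theta> t] (rmod (2 * pi))) \<and>
        (\<forall>t\<ge>0. continuous (at t within {0..}) \<omega> \<longrightarrow>
           (\<Theta> has_real_derivative \<omega> t) (at t within {0..})))"

definition admissible_inputs :: "(real \<Rightarrow> real) \<Rightarrow> (real \<Rightarrow> real) \<Rightarrow> bool" where
  "admissible_inputs \<nu> \<omega> \<longleftrightarrow>
     (\<forall>t\<ge>0. 0 \<le> \<nu> t) \<and> \<nu> differentiable_on {0..} \<and> piecewise_continuous \<omega>"

definition unicycle ::
  "(real \<Rightarrow> real ^ 2) \<Rightarrow> (real \<Rightarrow> real) \<Rightarrow> (real \<Rightarrow> real) \<Rightarrow> (real \<Rightarrow> real) \<Rightarrow> bool" where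
  "unicycle p \<theta> \<nu> \<omega> \<longleftrightarrow>
     (\<forall>t\<ge>0. \<theta> t \<in> {0..<2 * pi}) \<and>
     (\<forall>t\<ge>0. ((\<lambda>s. p s $ 1) has_real_derivative \<nu> t * cos (\<theta> t)) (at t within {0..})) \<and>
     (\<forall>t\<ge>0. ((\<lambda>s. p s $ 2) has_real_derivative \<nu> t * sin (\<theta> t)) (at t within {0..})) \<and>
     has_angular_velocity \<theta> \<omega>"

definition GNSS :: "(real \<Rightarrow> real ^ 2) \<Rightarrow> real \<Rightarrow> real ^ 2" where
  "GNSS p = (\<lambda>t. p t)"

definition spoofed_GNSS :: "(real \<Rightarrow> real ^ 2) \<Rightarrow> (real \<Rightarrow> real ^ 2) \<Rightarrow> real \<Rightarrow> real ^ 2" where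
  "spoofed_GNSS p u = (\<lambda>t. p t + u t)"

definition RSSI :: "(real \<Rightarrow> real ^ 2) \<Rightarrow> real \<Rightarrow> real" where
  "RSSI p = (\<lambda>t. p t \<bullet> p t)"

text \<open>
  The attack enters through the spoofing signal \<open>u\<close> and through the trajectory \<open>p\<close> that its
  controls generate; \<open>p\<^sub>n\<close> is the nominal trajectory.
\<close>

definition undetectable ::
  "(real \<Rightarrow> real ^ 2) \<Rightarrow> (real \<Rightarrow> real ^ 2) \<Rightarrow> (real \<Rightarrow> real ^ 2) \<Rightarrow> bool" where
  "undetectable p\<^sub>n p u \<longleftrightarrow>
     (\<forall>t\<ge>0. spoofed_GNSS p u t = GNSS p\<^sub>n t \<and> RSSI p t = RSSI p\<^sub>n t)"

definition angle :: "real ^ 2 \<Rightarrow> real ^ 2 \<Rightarrow> real" where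
  "angle a b = (if a = 0 \<or> b = 0 then 0 else arccos ((a \<bullet> b) / (norm a * norm b)))"

end

theory Submission
  imports Defs
begin

text \<open>
  For a planar motion \<open>p\<close> with velocity \<open>v\<close>, the quantity \<open>norm v * cos (angle (p t) v)\<close> is the
  rate at which the distance \<open>norm (p t)\<close> from the origin grows.  Away from the origin this is the
  usual formula \<open>p \<bullet> v / norm p\<close>.  At the origin the distance need not be differentiable, but it
  still has a right derivative, namely \<open>norm v\<close>; and this is what the formula gives, because the
  angle with the zero vector is \<open>0\<close>.  So the right derivative of \<open>norm (p t)\<close> is
  \<open>norm v * cos (angle (p t) v)\<close> at every time, without exception
  (\<open>has_right_derivative_norm\<close>), and for the unicycle \<open>norm v\<close> is the wheel velocity \<open>\<nu>\<close>.

  The GNSS condition is \<open>u = p\<^sub>n - p\<close>.  The RSSI condition says that \<open>norm p\<close> and \<open>norm p\<^sub>n\<close> agree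
  at all times.  If they agree, so do their right derivatives, which are \<open>\<nu> cos \<phi>\<close> and
  \<open>\<nu>\<^sub>n cos \<phi>\<^sub>n\<close>.  Conversely, if the right derivatives agree, the continuous function
  \<open>norm p - norm p\<^sub>n\<close> has right derivative zero everywhere; such a function is constant
  (\<open>right_derivative_zero_imp_constant\<close>), and it vanishes at time \<open>0\<close>.  Working with right
  derivatives avoids any discussion of the set of times at which a trajectory meets the origin,
  which may be uncountable since the robot may wait there.
\<close>

text \<open>
  The derivative bounds the increments only to the right of a point, so the mean value theorem does
  not apply.  Instead, the bound \<open>\<epsilon> (t - a)\<close> on \<open>norm (f t - f a)\<close> is propagated from left to
  right: at the last time where it holds, the zero right derivative extends it a little further,
  unless that time is \<open>b\<close>.  Then \<open>\<epsilon>\<close> tends to \<open>0\<close>.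
\<close>

lemma right_derivative_zero_imp_constant:
  fixes f :: "real \<Rightarrow> 'a :: real_normed_vector"
  assumes "a \<le> b" and cont: "continuous_on {a..b} f"
    and deriv: "\<And>t. a \<le> t \<Longrightarrow> t < b \<Longrightarrow> (f has_vector_derivative 0) (at_right t)"
  shows "f b = f a"
proof -
  have bound: "norm (f b - f a) \<le> e * (b - a)" if "e > 0" for e
  proof -
    define S where "S = {t \<in> {a..b}. norm (f t - f a) \<le> e * (t - a)}"
    have "closed S"
      unfolding S_def by (intro continuous_on_closed_Collect_le cont continuous_intros)
    moreover have "S \<subseteq> {a..b}"
      by (auto simp: S_def)
    ultimately have "compact S"
      by (metis compact_Icc compact_Int_closed inf.absorb2)
    moreover have "a \<in> S"
      using \<open>a \<le> b\<close> by (simp add: S_def)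
    ultimately obtain c where c: "c \<in> S" and last: "\<And>t. t \<in> S \<Longrightarrow> t \<le> c"
      using compact_attains_sup[of S] by blast
    have "c = b"
    proof (rule ccontr)
      assume "c \<noteq> b"
      with c have "a \<le> c" "c < b"
        by (auto simp: S_def)
      then have "(f has_vector_derivative 0) (at_right c)"
        by (rule deriv)
      then obtain d where "d > 0"
        and d: "\<And>t. t > c \<Longrightarrow> t - c < d \<Longrightarrow> norm (f t - f c) \<le> e * (t - c)"
        using \<open>e > 0\<close>
        unfolding has_vector_derivative_def has_derivative_within_alt
        by (smt (verit) diff_zero greaterThan_iff real_norm_def scale_zero_right)
      define t where "t = min b (c + d / 2)"
      have t: "c < t" "t \<le> b" "t - c < d"
        using \<open>c < b\<close> \<open>d > 0\<close> by (auto simp: t_def min_def field_simps)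
      have "norm (f t - f a) \<le> norm (f t - f c) + norm (f c - f a)"
        using norm_triangle_ineq[of "f t - f c" "f c - f a"] by simp
      also have "\<dots> \<le> e * (t - c) + e * (c - a)"
        using d[of t] t c by (auto simp: S_def)
      also have "\<dots> = e * (t - a)"
        by (simp add: algebra_simps)
      finally have "t \<in> S"
        using t \<open>a \<le> c\<close> by (simp add: S_def)
      with last[of t] t show False
        by simp
    qed
    with c show ?thesis
      by (simp add: S_def)
  qed
  have "norm (f b - f a) \<le> 0"
  proof (rule field_le_epsilon)
    fix e :: real
    assume "e > 0"
    have "norm (f b - f a) \<le> e / (b - a + 1) * (b - a)"
      using \<open>e > 0\<close> \<open>a \<le> b\<close> by (intro bound) simp
    also have "\<dots> \<le> e"
      using \<open>e > 0\<close> \<open>a \<le> b\<close> by (simp add: field_simps)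
    finally show "norm (f b - f a) \<le> 0 + e"
      by simp
  qed
  then show ?thesis
    by simp
qed

lemma norm_mult_cos_angle:
  "norm b * cos (angle a b) = (if a = 0 then norm b else a \<bullet> b / norm a)"
proof (cases "a = 0 \<or> b = 0")
  case False
  have "\<bar>(a \<bullet> b) / (norm a * norm b)\<bar> \<le> 1"
    using False Cauchy_Schwarz_ineq2[of a b] by (simp add: abs_mult)
  then show ?thesis
    using False by (simp add: angle_def cos_arccos_abs)
qed (auto simp: angle_def)

text \<open>
  At a zero of \<open>p\<close> the one-sidedness is essential: only for \<open>s > t\<close> is \<open>(s - t) * norm v\<close> the norm
  of the linear approximation \<open>(s - t) *\<^sub>R v\<close>, so that the reverse triangle inequality bounds the
  error for \<open>norm p\<close> by the error for \<open>p\<close>.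
\<close>

lemma has_right_derivative_norm:
  fixes p :: "real \<Rightarrow> real ^ 2"
  assumes p: "(p has_vector_derivative v) (at_right t)"
  shows "((\<lambda>s. norm (p s)) has_vector_derivative norm v * cos (angle (p t) v)) (at_right t)"
proof (cases "p t = 0")
  case False
  have "(p has_derivative (\<lambda>h. h *\<^sub>R v)) (at_right t)"
    using p by (simp add: has_vector_derivative_def)
  from has_derivative_compose[OF this has_derivative_norm[OF False]] show ?thesis
    using False
    by (simp add: has_vector_derivative_def norm_mult_cos_angle sgn_div_norm inner_commute
        divide_inverse mult_ac)
next
  case True
  have "((\<lambda>s. norm ((p s - (s - t) *\<^sub>R v) /\<^sub>R norm (s - t))) \<longlongrightarrow> 0) (at_right t)"
    using p True
    by (intro tendsto_norm_zero) (simp add: has_vector_derivative_def has_derivative_within divide_inverse)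
  moreover have "\<forall>\<^sub>F s in at_right t.
      norm ((norm (p s) - (s - t) * norm v) /\<^sub>R norm (s - t))
        \<le> norm ((p s - (s - t) *\<^sub>R v) /\<^sub>R norm (s - t))"
    using eventually_at_right_less
  proof (rule eventually_mono)
    fix s :: real
    assume "t < s"
    then have "\<bar>norm (p s) - (s - t) * norm v\<bar> \<le> norm (p s - (s - t) *\<^sub>R v)"
      using norm_triangle_ineq3[of "p s" "(s - t) *\<^sub>R v"] by simp
    then show "norm ((norm (p s) - (s - t) * norm v) /\<^sub>R norm (s - t))
        \<le> norm ((p s - (s - t) *\<^sub>R v) /\<^sub>R norm (s - t))"
      by (simp add: abs_mult mult_left_mono)
  qed
  ultimately have "((\<lambda>s. (norm (p s) - (s - t) * norm v) /\<^sub>R norm (s - t)) \<longlongrightarrow> 0) (at_right t)"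
    by (rule Lim_null_comparison[rotated])
  then show ?thesis
    using True
    by (simp add: has_vector_derivative_def has_derivative_within norm_mult_cos_angle
        bounded_linear_mult_left divide_inverse)
qed

lemma unicycle_has_vector_derivative:
  assumes "unicycle p \<theta> \<nu> \<omega>" and "t \<ge> 0"
  shows "(p has_vector_derivative \<nu> t *\<^sub>R vector [cos (\<theta> t), sin (\<theta> t)]) (at t within {0..})"
proof -
  define v where "v = \<nu> t *\<^sub>R (vector [cos (\<theta> t), sin (\<theta> t)] :: real ^ 2)"
  have "((\<lambda>s. p s $ 1) has_real_derivative v $ 1) (at t within {0..})"
    and "((\<lambda>s. p s $ 2) has_real_derivative v $ 2) (at t within {0..})"
    using assms by (simp_all add: unicycle_def v_def)
  then have "\<forall>i. ((\<lambda>s. p s $ i) has_vector_derivative v $ i) (at t within {0..})"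
    unfolding has_real_derivative_iff_has_vector_derivative forall_2 by blast
  then have "(p has_vector_derivative v) (at t within {0..})"
    unfolding has_vector_derivative_def
    by (subst has_derivative_componentwise_within) (simp add: Basis_vec_def inner_axis)
  then show ?thesis
    by (simp only: v_def)
qed

lemma norm_unit_direction: "norm (vector [cos x, sin x] :: real ^ 2) = 1"
  by (simp add: norm_eq_sqrt_inner inner_vec_def sum_2 flip: power2_eq_square)

text \<open>
  This is where \<open>\<nu> cos \<phi>\<close> is recognised as the radial speed.  The sign condition on \<open>\<nu>\<close> makes it
  the norm of the velocity.
\<close>

lemma unicycle_right_derivative_norm:
  assumes uni: "unicycle p \<theta> \<nu> \<omega>" and "t \<ge> 0" and "\<nu> t \<ge> 0"
  shows "((\<lambda>s. norm (p s)) has_vector_derivative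
      \<nu> t * cos (angle (p t) (vector_derivative p (at t within {0..})))) (at_right t)"
proof -
  define v where "v = \<nu> t *\<^sub>R (vector [cos (\<theta> t), sin (\<theta> t)] :: real ^ 2)"
  have v: "(p has_vector_derivative v) (at t within {0..})"
    unfolding v_def using uni \<open>t \<ge> 0\<close> by (rule unicycle_has_vector_derivative)
  have "at t within {0..} \<noteq> bot"
  proof -
    have "at_right t \<le> at t within {0..}"
      using \<open>t \<ge> 0\<close> by (intro at_le) auto
    then show ?thesis
      using trivial_limit_at_right_real[of t] by (metis bot.extremum_uniqueI)
  qed
  then have "vector_derivative p (at t within {0..}) = v"
    using v by (rule vector_derivative_within)
  moreover have "norm v = \<nu> t"
    using \<open>\<nu> t \<ge> 0\<close> by (simp add: v_def norm_unit_direction)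
  moreover have "(p has_vector_derivative v) (at_right t)"
    using \<open>t \<ge> 0\<close> by (intro has_vector_derivative_within_subset[OF v]) auto
  ultimately show ?thesis
    using has_right_derivative_norm by metis
qed

lemma unicycle_continuous_on:
  assumes "unicycle p \<theta> \<nu> \<omega>"
  shows "continuous_on {0..} p"
  using unicycle_has_vector_derivative[OF assms]
  by (intro continuous_on_vector_derivative) auto

text \<open>
  Applied to the distances of two trajectories from the origin, this is the equivalence between
  equal RSSI measurements and equal radial speeds.
\<close>

lemma eq_iff_right_derivatives_eq:
  fixes f g :: "real \<Rightarrow> 'a :: real_normed_vector"
  assumes "continuous_on {a..} f" and "continuous_on {a..} g" and "f a = g a"
    and f: "\<And>t. t \<ge> a \<Longrightarrow> (f has_vector_derivative f' t) (at_right t)"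
    and g: "\<And>t. t \<ge> a \<Longrightarrow> (g has_vector_derivative g' t) (at_right t)"
  shows "(\<forall>t\<ge>a. f t = g t) \<longleftrightarrow> (\<forall>t\<ge>a. f' t = g' t)"
proof
  assume eq: "\<forall>t\<ge>a. f t = g t"
  show "\<forall>t\<ge>a. f' t = g' t"
  proof (intro allI impI)
    fix t
    assume "t \<ge> a"
    \<comment> \<open>The closed half-line is the same filter, but it contains the base point \<open>t\<close>, whose value
      enters the difference quotients.\<close>
    have "(f has_vector_derivative f' t) (at t within {t..})"
      using f[OF \<open>t \<ge> a\<close>] by (simp add: at_within_Ici_at_right)
    then have "(g has_vector_derivative f' t) (at t within {t..})"
      using eq \<open>t \<ge> a\<close> by (intro has_vector_derivative_transform[of t "{t..}" g f]) auto
    then have "(g has_vector_derivative f' t) (at_right t)"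
      by (simp add: at_within_Ici_at_right)
    with g[OF \<open>t \<ge> a\<close>] show "f' t = g' t"
      by (intro vector_derivative_unique_within[OF trivial_limit_at_right_real])
  qed
next
  assume eq: "\<forall>t\<ge>a. f' t = g' t"
  show "\<forall>t\<ge>a. f t = g t"
  proof (intro allI impI)
    fix t
    assume "t \<ge> a"
    have "f t - g t = f a - g a"
    proof (rule right_derivative_zero_imp_constant[OF \<open>t \<ge> a\<close>])
      show "continuous_on {a..t} (\<lambda>s. f s - g s)"
        by (intro continuous_intros continuous_on_subset[OF assms(1)]
            continuous_on_subset[OF assms(2)]) auto
      show "((\<lambda>s. f s - g s) has_vector_derivative 0) (at_right s)" if "a \<le> s" for s
        using has_vector_derivative_diff[OF f[OF that] g[OF that]] eq that by simp
    qed
    with \<open>f a = g a\<close> show "f t = g t"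
      by simp
  qed
qed

theorem theorem15:
  fixes p\<^sub>n p u :: "real \<Rightarrow> real ^ 2"
    and \<theta>\<^sub>n \<nu>\<^sub>n \<omega>\<^sub>n \<theta> \<nu> \<omega> \<phi>\<^sub>n \<phi> :: "real \<Rightarrow> real"
    and \<nu>\<^sub>m\<^sub>a\<^sub>x \<omega>\<^sub>m\<^sub>a\<^sub>x :: real
  assumes "\<nu>\<^sub>m\<^sub>a\<^sub>x > 0" and "\<omega>\<^sub>m\<^sub>a\<^sub>x > 0"
    and "admissible_inputs \<nu>\<^sub>n \<omega>\<^sub>n"
    and "\<And>t. t \<ge> 0 \<Longrightarrow> \<nu>\<^sub>n t \<le> \<nu>\<^sub>m\<^sub>a\<^sub>x" and "\<And>t. t \<ge> 0 \<Longrightarrow> \<bar>\<omega>\<^sub>n t\<bar> \<le> \<omega>\<^sub>m\<^sub>a\<^sub>x"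
    and "unicycle p\<^sub>n \<theta>\<^sub>n \<nu>\<^sub>n \<omega>\<^sub>n"
    and "admissible_inputs \<nu> \<omega>"
    and "unicycle p \<theta> \<nu> \<omega>"
    and "p 0 = p\<^sub>n 0" and "\<theta> 0 = \<theta>\<^sub>n 0"
    and "\<And>t. t \<ge> 0 \<Longrightarrow> \<phi>\<^sub>n t = angle (p\<^sub>n t) (vector_derivative p\<^sub>n (at t within {0..}))"
    and "\<And>t. t \<ge> 0 \<Longrightarrow> \<phi> t = angle (p t) (vector_derivative p (at t within {0..}))"
  shows "undetectable p\<^sub>n p u \<longleftrightarrow>
    (\<forall>t\<ge>0. \<nu> t * cos (\<phi> t) = \<nu>\<^sub>n t * cos (\<phi>\<^sub>n t) \<and> u t = p\<^sub>n t - p t)"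
proof -
  have "(\<forall>t\<ge>0. norm (p t) = norm (p\<^sub>n t)) \<longleftrightarrow>
      (\<forall>t\<ge>0. \<nu> t * cos (\<phi> t) = \<nu>\<^sub>n t * cos (\<phi>\<^sub>n t))"
  proof (rule eq_iff_right_derivatives_eq)
    show "continuous_on {0..} (\<lambda>t. norm (p t))" "continuous_on {0..} (\<lambda>t. norm (p\<^sub>n t))"
      using assms(6,8) by (auto intro: continuous_on_norm unicycle_continuous_on)
    show "norm (p 0) = norm (p\<^sub>n 0)"
      using assms(9) by simp
    fix t :: real
    assume "t \<ge> 0"
    then show "((\<lambda>s. norm (p s)) has_vector_derivative \<nu> t * cos (\<phi> t)) (at_right t)"
      using unicycle_right_derivative_norm[OF assms(8)] assms(7,12)
      by (simp add: admissible_inputs_def)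
    show "((\<lambda>s. norm (p\<^sub>n s)) has_vector_derivative \<nu>\<^sub>n t * cos (\<phi>\<^sub>n t)) (at_right t)"
      using unicycle_right_derivative_norm[OF assms(6)] assms(3,11) \<open>t \<ge> 0\<close>
      by (simp add: admissible_inputs_def)
  qed
  moreover have "RSSI p t = RSSI p\<^sub>n t \<longleftrightarrow> norm (p t) = norm (p\<^sub>n t)" for t
    by (simp add: RSSI_def norm_eq)
  moreover have "spoofed_GNSS p u t = GNSS p\<^sub>n t \<longleftrightarrow> u t = p\<^sub>n t - p t" for t
    by (auto simp: spoofed_GNSS_def GNSS_def algebra_simps)
  ultimately show ?thesis
    unfolding undetectable_def by blast
qed

end
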